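(* Let $n\ge 3$ and let $C_n$ denote the cycle graph on $n$ vertices. For every integer $\ell$ with $0\le \ell\le n$, $$Z^+_{(\ell)}(C_n) = \begin{cases} 2 & \text{if } \ell \in\{0,1\},\\ n & \text{if } \ell \ge 2.\end{cases}$$
   Context: All graphs are finite, simple and undirected. Positive semidefinite (psd) color change rule: given the current set $B$ of blue vertices of a graph $G$, let $W_1,\dots,W_k$ be the vertex sets of the connected components of $G-B$. If $u\in B$ and $w\in W_i$ is the only non-blue neighbor of $u$ in the induced subgraph $G[W_i\cup B]$, then $u$ may force $w$ (written $u\to w$), and $w$ becomes blue. The rule is applied iteratively, with the components recomputed from the current blue set. A leak is a vertex that is not allowed to perform any force. For $0\le \ell\le |V(G)|$, a set $B\subseteq V(G)$ is an $\ell$-leaky positive semidefinite forcing set of $G$ if, for every choice of $\ell$ vertices as leaks (chosen after $B$ is fixed; leaks may be inside or outside $B$), starting with exactly $B$ blue, iterated application of the psd color change rule, with forces performed only by non-leak vertices, colors all of $V(G)$ blue. The $\ell$-leaky positive semidefinite forcing number $Z^+_{(\ell)}(G)$ is the minimum cardinality of an $\ell$-leaky positive semidefinite forcing set of $G$. *)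

theory Defs
  imports "Graph_Theory.Graph_Theory"
begin

text \<open>Graphs are the locale \<^locale>\<open>graph\<close>: finite symmetric digraphs without loops or
  parallel arcs.\<close>

context graph
begin

text \<open>In a symmetric digraph the strongly connected components are the connected components of
  the underlying undirected graph.\<close>

definition psd_components :: "'a set \<Rightarrow> 'a set set" where
  "psd_components B = pre_digraph.sccs_verts (G \<restriction> (verts G - B))"

definition psd_force :: "'a set \<Rightarrow> 'a \<Rightarrow> 'a \<Rightarrow> bool" where
  "psd_force B u w \<longleftrightarrow> u \<in> B \<and>
     (\<exists>W \<in> psd_components B. w \<in> W \<and>
        {v \<in> verts (G \<restriction> (W \<union> B)) - B. u \<rightarrow>\<^bsub>G \<restriction> (W \<union> B)\<^esub> v} = {w})"

definition leaky_psd_step :: "'a set \<Rightarrow> 'a set \<Rightarrow> 'a set \<Rightarrow> bool" where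
  "leaky_psd_step L B B' \<longleftrightarrow> (\<exists>u w. u \<notin> L \<and> psd_force B u w \<and> B' = insert w B)"

text \<open>A force that is available stays available until its target is blue, so the order of the
  forces is irrelevant, and it suffices that some sequence of forces reaches all vertices.\<close>

definition leaky_psd_forcing_set :: "nat \<Rightarrow> 'a set \<Rightarrow> bool" where
  "leaky_psd_forcing_set l B \<longleftrightarrow> B \<subseteq> verts G \<and>
     (\<forall>L. L \<subseteq> verts G \<and> card L = l \<longrightarrow> (leaky_psd_step L)\<^sup>*\<^sup>* B (verts G))"

text \<open>Meaningful for \<open>l \<le> card (verts G)\<close>; for larger \<open>l\<close> there is no choice of leaks and every
  set of vertices qualifies vacuously.\<close>

definition leaky_psd_forcing_number :: "nat \<Rightarrow> nat" where
  "leaky_psd_forcing_number l = (LEAST k. \<exists>B. leaky_psd_forcing_set l B \<and> card B = k)"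

end

text \<open>A cycle in the graph-theoretic sense only for \<open>n \<ge> 3\<close>.\<close>

definition cycle_graph :: "nat \<Rightarrow> nat pair_pre_digraph" where
  "cycle_graph n = \<lparr> pverts = {..<n},
     parcs = {(i, j). i < n \<and> j < n \<and> (j = (i + 1) mod n \<or> i = (j + 1) mod n)} \<rparr>"

lemma pair_graph_cycle_graph:
  assumes "n \<ge> 3"
  shows "pair_graph (cycle_graph n)"
proof
  show "finite (parcs (cycle_graph n))"
    by (rule finite_subset[of _ "{..<n} \<times> {..<n}"]) (auto simp: cycle_graph_def)
  show "fst e \<noteq> snd e" if "e \<in> parcs (cycle_graph n)" for e
    using that assms by (auto simp: cycle_graph_def mod_Suc split: if_splits)
  show "symmetric (with_proj (cycle_graph n))"
    by (auto simp: cycle_graph_def symmetric_def sym_def)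
qed (auto simp: cycle_graph_def)

lemma graph_cycle_graph: "n \<ge> 3 \<Longrightarrow> graph (with_proj (cycle_graph n))"
proof -
  assume "n \<ge> 3"
  then interpret pair_graph "cycle_graph n" by (rule pair_graph_cycle_graph)
  show ?thesis by unfold_locales
qed

end

(* With at least two leaks, a white vertex stays white as soon as both its neighbours leak, so every
   vertex must be blue from the start. For at most one leak, two adjacent blue vertices suffice:
   the blue arc grows from either end, in one direction up to the leak and in the other direction up
   to the vertex next to it. A single vertex u forces nothing, since the rest of the cycle is one
   component, which contains both neighbours of u. *)

theory Submission
  imports Defs
begin

section \<open>Components and forces in an arbitrary graph\<close>

context graph
begin

lemma dominates_induce_subgraph_iff:
  "u \<rightarrow>\<^bsub>G \<restriction> S\<^esub> v \<longleftrightarrow> u \<rightarrow>\<^bsub>G\<^esub> v \<and> u \<in> S \<and> v \<in> S"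
  by (auto simp: arcs_ends_conv)

lemma psd_component_subset:
  assumes "W \<in> psd_components B"
  shows "W \<subseteq> verts G - B"
proof -
  interpret H: wf_digraph "G \<restriction> (verts G - B)"
    by (rule wellformed_induce_subgraph)
  from assms H.sccs_verts_subsets show ?thesis
    by (auto simp: psd_components_def)
qed

lemma psd_component_ex:
  assumes "w \<in> verts G - B"
  shows "\<exists>W \<in> psd_components B. w \<in> W"
proof -
  interpret H: wf_digraph "G \<restriction> (verts G - B)"
    by (rule wellformed_induce_subgraph)
  from assms have "w \<in> verts (G \<restriction> (verts G - B))"
    by simp
  then show ?thesis
    unfolding psd_components_def using H.scc_of_in_sccs_verts H.in_scc_of_self by blast
qed

text \<open>Between white vertices an arc and its reverse both survive in the subgraph induced by
  the white vertices, so the two ends reach each other and share a strongly connected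
  component.\<close>

lemma psd_component_closed:
  assumes "W \<in> psd_components B" "v \<in> W" "v \<rightarrow>\<^bsub>G\<^esub> w" "w \<notin> B"
  shows "w \<in> W"
proof -
  interpret H: wf_digraph "G \<restriction> (verts G - B)"
    by (rule wellformed_induce_subgraph)
  have v: "v \<in> verts G - B"
    using assms psd_component_subset by blast
  have w: "w \<in> verts G - B"
    using assms by auto
  have "w \<rightarrow>\<^bsub>G\<^esub> v"
    using assms(3) sym_arcs by (auto simp: symmetric_def dest: symD)
  with v w assms(3) have "v \<rightarrow>\<^bsub>G \<restriction> (verts G - B)\<^esub> w" "w \<rightarrow>\<^bsub>G \<restriction> (verts G - B)\<^esub> v"
    unfolding dominates_induce_subgraph_iff by auto
  then have "v \<rightarrow>\<^sup>*\<^bsub>G \<restriction> (verts G - B)\<^esub> w" "w \<rightarrow>\<^sup>*\<^bsub>G \<restriction> (verts G - B)\<^esub> v"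
    by auto
  with assms(1,2) show ?thesis
    unfolding psd_components_def H.in_sccs_verts_conv_reachable by blast
qed

text \<open>Eliminates the induced subgraph: \<open>W\<close> avoids \<open>B\<close>, so deleting
  \<open>B\<close> from \<open>W \<union> B\<close> leaves \<open>W\<close>, and for
  \<open>u\<close> in \<open>B\<close> the arcs from \<open>u\<close> into \<open>W\<close> are
  those of \<open>G\<close>.\<close>

lemma psd_force_iff:
  "psd_force B u w \<longleftrightarrow>
     u \<in> B \<and> (\<exists>W \<in> psd_components B. w \<in> W \<and> {v \<in> W. u \<rightarrow>\<^bsub>G\<^esub> v} = {w})"
proof -
  have "{v \<in> verts (G \<restriction> (W \<union> B)) - B. u \<rightarrow>\<^bsub>G \<restriction> (W \<union> B)\<^esub> v} = {v \<in> W. u \<rightarrow>\<^bsub>G\<^esub> v}"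
    if "u \<in> B" "W \<in> psd_components B" for W
    using that psd_component_subset[OF that(2)] unfolding dominates_induce_subgraph_iff by auto
  then show ?thesis
    unfolding psd_force_def by (metis (no_types, lifting))
qed

text \<open>The standard zero forcing rule is a special case: a white neighbour that is unique in
  \<open>G\<close> is unique in its component. All forces constructed below are of this
  kind.\<close>

lemma psd_forceI:
  assumes "u \<in> B" "w \<notin> B" "u \<rightarrow>\<^bsub>G\<^esub> w" "\<And>v. u \<rightarrow>\<^bsub>G\<^esub> v \<Longrightarrow> v \<in> B \<or> v = w"
  shows "psd_force B u w"
proof -
  obtain W where W: "W \<in> psd_components B" "w \<in> W"
    using psd_component_ex[of w B] assms(2) adj_in_verts(2)[OF assms(3)] by auto
  moreover have "{v \<in> W. u \<rightarrow>\<^bsub>G\<^esub> v} = {w}"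
    using assms psd_component_subset[OF W(1)] W(2) by auto
  ultimately show ?thesis
    using assms(1) by (auto simp: psd_force_iff)
qed

lemma psd_force_dominates: "psd_force B u w \<Longrightarrow> u \<rightarrow>\<^bsub>G\<^esub> w"
  unfolding psd_force_iff by auto

text \<open>If \<open>w\<close> were white initially, all its neighbours could be made leaks; every
  force on \<open>w\<close> comes from a neighbour, so \<open>w\<close> would stay white.\<close>

lemma degree_le_leaks_imp_in_forcing_set:
  assumes "leaky_psd_forcing_set l B" "w \<in> verts G" "card {u. u \<rightarrow>\<^bsub>G\<^esub> w} \<le> l" "l \<le> card (verts G)"
  shows "w \<in> B"
proof (rule ccontr)
  assume "w \<notin> B"
  have "{u. u \<rightarrow>\<^bsub>G\<^esub> w} \<subseteq> verts G"
    by auto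
  \<comment> \<open>The number of leaks is exactly \<open>l\<close>, so the neighbourhood is padded
    with further vertices; \<open>l \<le> card (verts G)\<close> leaves room for this.\<close>
  then obtain L where L: "{u. u \<rightarrow>\<^bsub>G\<^esub> w} \<subseteq> L" "L \<subseteq> verts G" "card L = l"
    using exists_subset_between[of "{u. u \<rightarrow>\<^bsub>G\<^esub> w}" l "verts G"] assms(3,4) by auto
  have "w \<notin> B'" if "(leaky_psd_step L)\<^sup>*\<^sup>* B B'" for B'
    using that
  proof induction
    case base
    show ?case by fact
  next
    case (step X Y)
    then show ?case
      using L(1) psd_force_dominates unfolding leaky_psd_step_def by auto
  qed
  with assms(1,2) L(2,3) show False
    unfolding leaky_psd_forcing_set_def by blast
qed

end

section \<open>Adjacency in the cycle\<close>

lemma mod_add_eq_if: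
  fixes a b n :: nat
  assumes "a < n" "b < n"
  shows "(a + b) mod n = (if a + b < n then a + b else a + b - n)"
  using assms by (simp add: le_mod_geq)

lemma pverts_cycle_graph: "pverts (cycle_graph n) = {..<n}"
  by (simp add: cycle_graph_def)

lemma dominates_cycle_graph_iff:
  "u \<rightarrow>\<^bsub>with_proj (cycle_graph n)\<^esub> v \<longleftrightarrow>
     u < n \<and> v < n \<and> (v = (u + 1) mod n \<or> u = (v + 1) mod n)"
  by (simp add: cycle_graph_def)

context
  fixes n :: nat
  assumes n: "n \<ge> 3"
begin

interpretation graph "with_proj (cycle_graph n)"
  using n by (rule graph_cycle_graph)

lemma leaky_psd_forcing_set_cycle_graph_iff:
  "leaky_psd_forcing_set l B \<longleftrightarrow>
     B \<subseteq> {..<n} \<and> (\<forall>L. L \<subseteq> {..<n} \<and> card L = l \<longrightarrow> (leaky_psd_step L)\<^sup>*\<^sup>* B {..<n})"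
  by (simp add: leaky_psd_forcing_set_def pverts_cycle_graph)

lemma psd_force_cycle_graphI:
  assumes "u \<in> B" "w \<notin> B" "u < n" "w < n" "w = (u + 1) mod n \<or> u = (w + 1) mod n"
    and "\<And>v. v < n \<Longrightarrow> v = (u + 1) mod n \<or> u = (v + 1) mod n \<Longrightarrow> v \<in> B \<or> v = w"
  shows "psd_force B u w"
  by (rule psd_forceI; (unfold dominates_cycle_graph_iff)?) (use assms in blast)+

lemma card_neighbours_cycle_graph: "card {u. u \<rightarrow>\<^bsub>with_proj (cycle_graph n)\<^esub> w} \<le> 2"
proof -
  have "{u. u \<rightarrow>\<^bsub>with_proj (cycle_graph n)\<^esub> w} \<subseteq> {(w + 1) mod n, if w = 0 then n - 1 else w - 1}"
    unfolding dominates_cycle_graph_iff by (auto simp: mod_Suc split: if_splits)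
  then have "card {u. u \<rightarrow>\<^bsub>with_proj (cycle_graph n)\<^esub> w}
      \<le> card {(w + 1) mod n, if w = 0 then n - 1 else w - 1}"
    by (intro card_mono) auto
  also have "\<dots> \<le> 2"
    by (simp add: card_insert_if)
  finally show ?thesis .
qed

section \<open>Lower bound: one blue vertex is stuck\<close>

lemma not_psd_force_singleton_cycle_graph: "\<not> psd_force {u} u w"
proof
  assume "psd_force {u} u w"
  then obtain W where W: "W \<in> psd_components {u}" "w \<in> W"
      and only: "{v \<in> W. u \<rightarrow>\<^bsub>with_proj (cycle_graph n)\<^esub> v} = {w}"
    by (auto simp: psd_force_iff)
  \<comment> \<open>The successor and the predecessor of \<open>u\<close>. Writing the latter as
    \<open>u + (n - 1)\<close> makes it the last vertex of the walk \<open>u + i\<close> with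
    \<open>1 \<le> i < n\<close>.\<close>
  let ?p = "(u + 1) mod n" and ?q = "(u + (n - 1)) mod n"
  have adj: "u \<rightarrow>\<^bsub>with_proj (cycle_graph n)\<^esub> w"
    using only by auto
  then have u: "u < n"
    unfolding dominates_cycle_graph_iff by blast
  have p: "?p = (if u + 1 = n then 0 else u + 1)"
    using u n by (simp add: mod_Suc)
  have q: "?q = (if u = 0 then n - 1 else u - 1)"
    by (subst mod_add_eq_if) (use u n in auto)
  have w: "w = ?p \<or> w = ?q"
    using adj unfolding q dominates_cycle_graph_iff by (auto simp: mod_Suc split: if_splits)
  have neq: "(u + i) mod n \<noteq> u" if "1 \<le> i" "i < n" for i
    using that u by (auto simp: mod_add_eq_if)
  \<comment> \<open>The walk from \<open>?p\<close> round to \<open>?q\<close> avoids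
    \<open>u\<close>, the only blue vertex, so it never leaves a component. An equivalence is proved
    because \<open>w\<close> may be either end of the walk.\<close>
  have all: "(u + i) mod n \<in> W \<longleftrightarrow> ?p \<in> W" if "1 \<le> i" "i < n" for i
    using that
  proof (induction i rule: dec_induct)
    case base
    show ?case by simp
  next
    case (step i)
    let ?a = "(u + i) mod n" and ?b = "(u + Suc i) mod n"
    have ab: "?a \<rightarrow>\<^bsub>with_proj (cycle_graph n)\<^esub> ?b" "?b \<rightarrow>\<^bsub>with_proj (cycle_graph n)\<^esub> ?a"
      using n unfolding dominates_cycle_graph_iff by (auto simp: mod_Suc_eq)
    have "?a \<notin> {u}" "?b \<notin> {u}"
      using neq[of i] neq[of "Suc i"] step by auto
    then have "?b \<in> W \<longleftrightarrow> ?a \<in> W"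
      using psd_component_closed[OF W(1)] ab by blast
    with step show ?case by simp
  qed
  have only': "v = w" if "v \<in> W" "u \<rightarrow>\<^bsub>with_proj (cycle_graph n)\<^esub> v" for v
    using only that by blast
  have in_W: "?p \<in> W" "?q \<in> W"
    using w W(2) all[of "n - 1"] n by auto
  have "u \<rightarrow>\<^bsub>with_proj (cycle_graph n)\<^esub> ?p" "u \<rightarrow>\<^bsub>with_proj (cycle_graph n)\<^esub> ?q"
    using u n unfolding p q dominates_cycle_graph_iff by auto
  \<comment> \<open>Uniqueness of the white neighbour in \<open>W\<close> identifies the two
    neighbours of \<open>u\<close>, which are distinct since \<open>n \<ge> 3\<close>.\<close>
  from this[THEN only'[rotated]] in_W have "?p = ?q"
    by simp
  then show False
    using u n unfolding p q by (simp split: if_splits)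
qed

lemma leaky_psd_forcing_set_cycle_graph_card_ge:
  assumes "leaky_psd_forcing_set l B" "l \<le> n"
  shows "2 \<le> card B"
proof (rule ccontr)
  assume "\<not> 2 \<le> card B"
  have B: "B \<subseteq> {..<n}" "finite B"
    using assms(1) by (auto simp: leaky_psd_forcing_set_cycle_graph_iff intro: finite_subset)
  \<comment> \<open>Any leak set of the right size serves, since the obstruction does not depend on
    the leaks.\<close>
  obtain L where L: "L \<subseteq> {..<n}" "card L = l"
    using obtain_subset_with_card_n[of l "{..<n}"] assms(2) by auto
  have no_step: "\<not> leaky_psd_step L B B'" for B'
  proof
    assume "leaky_psd_step L B B'"
    then obtain u w where uw: "psd_force B u w"
      by (auto simp: leaky_psd_step_def)
    then have "u \<in> B"
      by (simp add: psd_force_iff)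
    moreover have "card B \<le> Suc 0"
      using \<open>\<not> 2 \<le> card B\<close> by simp
    ultimately have "B = {u}"
      using B(2) by (auto simp: card_le_Suc0_iff_eq)
    with uw show False
      using not_psd_force_singleton_cycle_graph by blast
  qed
  have "(leaky_psd_step L)\<^sup>*\<^sup>* B {..<n}"
    using assms(1) L by (auto simp: leaky_psd_forcing_set_cycle_graph_iff)
  \<comment> \<open>With no first step available, the run must be empty.\<close>
  then have "B = {..<n}"
    using no_step by (cases rule: converse_rtranclpE) auto
  with \<open>\<not> 2 \<le> card B\<close> n show False
    by simp
qed

section \<open>Upper bound: growing a blue arc\<close>

lemma leaky_psd_steps_up_cycle_graph:
  assumes "1 \<le> a" "a \<le> t" "t < n" "\<And>i. a \<le> i \<Longrightarrow> i < t \<Longrightarrow> i \<notin> L"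
  shows "(leaky_psd_step L)\<^sup>*\<^sup>* {..a} {..t}"
  using assms(2,3,4)
proof (induction t rule: dec_induct)
  case base
  show ?case by simp
next
  case (step i)
  \<comment> \<open>As \<open>i \<ge> a \<ge> 1\<close>, the neighbour \<open>i - 1\<close> is
    already blue. For \<open>i = 0\<close> both neighbours would be white.\<close>
  have "psd_force {..i} i (Suc i)"
    using step assms(1)
    by (intro psd_force_cycle_graphI) (auto simp: mod_Suc split: if_splits)
  moreover have "i \<notin> L"
    using step by auto
  ultimately have "leaky_psd_step L {..i} {..Suc i}"
    unfolding leaky_psd_step_def atMost_Suc by blast
  with step show ?case
    by (auto intro: rtranclp.rtrancl_into_rtrancl)
qed

text \<open>The first force is from \<open>0\<close>, written \<open>n mod n\<close>, to
  \<open>n - 1\<close>; it is available because \<open>1 \<le> a\<close> makes the other neighbour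
  \<open>1\<close> blue. Each later force starts at the vertex coloured last. For
  \<open>b = n\<close> nothing is forced.\<close>

lemma leaky_psd_steps_down_cycle_graph:
  assumes "1 \<le> a" "a < b" "b \<le> n" "\<And>i. b < i \<Longrightarrow> i \<le> n \<Longrightarrow> i mod n \<notin> L"
  shows "(leaky_psd_step L)\<^sup>*\<^sup>* {..a} ({..a} \<union> {b..<n})"
  using assms(3,2,4)
proof (induction b rule: inc_induct)
  case base
  show ?case by simp
next
  case (step i)
  have "psd_force ({..a} \<union> {Suc i..<n}) (Suc i mod n) i"
    using step assms(1)
    by (intro psd_force_cycle_graphI) (auto simp: mod_Suc split: if_splits)
  moreover have "Suc i mod n \<notin> L"
    using step by auto
  moreover have "{..a} \<union> {i..<n} = insert i ({..a} \<union> {Suc i..<n})"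
    using step by auto
  ultimately have "leaky_psd_step L ({..a} \<union> {Suc i..<n}) ({..a} \<union> {i..<n})"
    unfolding leaky_psd_step_def by blast
  with step show ?case
    by (auto intro: rtranclp.rtrancl_into_rtrancl)
qed

lemma leaky_psd_forcing_set_cycle_graph_adjacent:
  assumes "l \<le> 1"
  shows "leaky_psd_forcing_set l {..1}"
  unfolding leaky_psd_forcing_set_cycle_graph_iff
proof (intro conjI allI impI)
  show "{..1} \<subseteq> {..<n}"
    using n by auto
next
  fix L
  assume L: "L \<subseteq> {..<n} \<and> card L = l"
  then have "finite L"
    by (auto intro: finite_subset)
  \<comment> \<open>With no leak at all, \<open>x = 0\<close> is an arbitrary choice.\<close>
  then obtain x where x: "x < n" "L \<subseteq> {x}"
  proof (cases "L = {}")
    case True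
    with that[of 0] n show ?thesis by auto
  next
    case False
    then obtain x where "x \<in> L" by blast
    moreover from this have "L \<subseteq> {x}"
      using L \<open>finite L\<close> assms by (auto simp: card_le_Suc0_iff_eq)
    ultimately show ?thesis
      using that L by blast
  qed
  \<comment> \<open>The upward forces start at \<open>1, ..., t - 1\<close>, the downward ones at
    \<open>t + 2, ..., n\<close>, with \<open>n\<close> standing for \<open>0\<close>. A leak
    \<open>x > 0\<close> is avoided by taking \<open>t = x\<close>. If \<open>x = 0\<close>, the
    upward run colours everything and the downward run is empty.\<close>
  define t where "t = (if x = 0 then n - 1 else x)"
  have "(leaky_psd_step L)\<^sup>*\<^sup>* {..1} {..t}"
    using x n by (intro leaky_psd_steps_up_cycle_graph) (auto simp: t_def)
  also have "(leaky_psd_step L)\<^sup>*\<^sup>* {..t} ({..t} \<union> {Suc t..<n})"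
    using x n by (intro leaky_psd_steps_down_cycle_graph) (auto simp: t_def le_mod_geq le_less split: if_splits)
  also have "{..t} \<union> {Suc t..<n} = {..<n}"
    using x n by (auto simp: t_def)
  finally show "(leaky_psd_step L)\<^sup>*\<^sup>* {..1} {..<n}" .
qed

section \<open>The value of the forcing number\<close>

lemma leaky_psd_forcing_number_cycle_graph:
  assumes "l \<le> n"
  shows "leaky_psd_forcing_number l = (if l \<in> {0, 1} then 2 else n)"
proof (cases "l \<le> 1")
  case True
  have "leaky_psd_forcing_number l = 2"
    unfolding leaky_psd_forcing_number_def
  proof (rule Least_equality)
    show "\<exists>B. leaky_psd_forcing_set l B \<and> card B = 2"
      using leaky_psd_forcing_set_cycle_graph_adjacent[OF True]
      by (intro exI[of _ "{..1}"]) simp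
  qed (use leaky_psd_forcing_set_cycle_graph_card_ge assms in blast)
  with True show ?thesis
    by auto
next
  case False
  \<comment> \<open>Here \<open>l \<ge> 2\<close> bounds every degree, so no vertex can be missing
    from \<open>B\<close>; the minimum then ranges over a single set.\<close>
  have "B = {..<n}" if "leaky_psd_forcing_set l B" for B
  proof
    show "B \<subseteq> {..<n}"
      using that by (simp add: leaky_psd_forcing_set_cycle_graph_iff)
    show "{..<n} \<subseteq> B"
      using degree_le_leaks_imp_in_forcing_set[OF that] assms False
        card_neighbours_cycle_graph[THEN order_trans, of l]
      by (auto simp: pverts_cycle_graph)
  qed
  moreover have "leaky_psd_forcing_set l {..<n}"
    by (auto simp: leaky_psd_forcing_set_cycle_graph_iff)
  ultimately have "(\<exists>B. leaky_psd_forcing_set l B \<and> card B = k) \<longleftrightarrow> k = n" for k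
    by (metis card_lessThan)
  then have "leaky_psd_forcing_number l = n"
    unfolding leaky_psd_forcing_number_def by (simp add: Least_equality)
  with False show ?thesis
    by auto
qed

end

theorem theorem21:
  fixes n l :: nat
  assumes "n \<ge> 3" and "l \<le> n"
  shows "graph.leaky_psd_forcing_number (with_proj (cycle_graph n)) l
           = (if l \<in> {0, 1} then 2 else n)"
  using assms by (rule leaky_psd_forcing_number_cycle_graph)

end
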